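(* If $P(x,y)=y^2+y(x+1)+x^2+x+1$ and $\omega=e^{2\pi i/3}$, then $$\pi m(P)=2D(i)-\tfrac{3}{4}D(\omega).$$
   Context: $m(P)=\frac{1}{(2\pi i)^2}\int_{T^2}\log|P(x,y)|\,\frac{dx}{x}\frac{dy}{y}$ is the logarithmic Mahler measure, where $T^2=\{(x,y)\in\mathbb{C}^2:|x|=|y|=1\}$. $D$ is the Bloch-Wigner dilogarithm, $D(z)=\mathrm{Im}(\mathrm{Li}_2(z))+\log|z|\arg(1-z)$ for $z\in\mathbb{C}\smallsetminus[1,\infty)$, extended continuously to $\mathbb{P}^1(\mathbb{C})$ (zero on the real axis and at $\infty$). *)

theory Defs
  imports "HOL-Complex_Analysis.Complex_Analysis"
begin

text \<open>
  The dilogarithm, continued analytically from the unit disc to the plane cut along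
  \<open>[1, \<infinity>)\<close>: \<open>Li\<^sub>2(z) = - \<integral>\<^sub>0\<^sup>z log(1 - t) dt / t\<close> along the straight segment, with principal
  logarithm. The integrand takes the value \<open>0\<close> at the removable singularity \<open>t = 0\<close>, which
  does not affect the integral. On the cut the value is not meaningful.
\<close>

definition dilog :: "complex \<Rightarrow> complex" where
  "dilog z = - contour_integral (linepath 0 z) (\<lambda>t. Ln (1 - t) / t)"

text \<open>
  The Bloch--Wigner dilogarithm on the finite points of the projective line. The continuous
  extension to the cut \<open>[1, \<infinity>)\<close> is \<open>0\<close>. At \<open>z = 0\<close> the formula gives \<open>0\<close>, since
  \<^term>\<open>Arg 1 = 0\<close>.
\<close>

definition bloch_wigner :: "complex \<Rightarrow> real" where
  "bloch_wigner z =
     (if z \<in> \<real> \<and> Re z \<ge> 1 then 0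
      else Im (dilog z) + ln (cmod z) * Arg (1 - z))"

text \<open>
  \<open>\<integral>\<integral> F(x, y) dx dy\<close> over the torus \<open>|x| = |y| = 1\<close>, both circles positively oriented, as a
  Lebesgue integral in the parameters \<open>x = e\<^sup>i\<^sup>s\<close>, \<open>y = e\<^sup>i\<^sup>t\<close>, where \<open>dx = i x ds\<close> and
  \<open>dy = i y dt\<close>.
\<close>

definition torus_integral :: "(complex \<Rightarrow> complex \<Rightarrow> complex) \<Rightarrow> complex" where
  "torus_integral F =
     (LINT (s, t):{0..2 * pi} \<times> {0..2 * pi}|(lborel :: (real \<times> real) measure).
        F (cis s) (cis t) * (\<i> * cis s) * (\<i> * cis t))"

text \<open>
  The value \<^term>\<open>ln (0::real) = 0\<close> at zeros of \<open>P\<close> is harmless: a nonzero polynomial vanishes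
  only on a null set of the torus.
\<close>

definition mahler_measure :: "(complex \<Rightarrow> complex \<Rightarrow> complex) \<Rightarrow> complex" where
  "mahler_measure P =
     1 / (2 * complex_of_real pi * \<i>)\<^sup>2 *
       torus_integral (\<lambda>x y. complex_of_real (ln (cmod (P x y))) / (x * y))"

end

theory Submission
  imports Defs
begin

text \<open>
  On the circle \<open>x = exp (i s)\<close> the substitution \<open>y = exp (i s / 2) w\<close> turns \<open>P\<close> into the real quadratic
  \<open>w\<^sup>2 + 2 c w + 4 c\<^sup>2 - 1\<close> with \<open>c = cos (s / 2)\<close>, so by Jensen's formula \<open>\<pi> m(P)\<close> is the sum of
  \<open>\<integral> ln (1 + 2 cos s) ds\<close> over \<open>[0, \<pi>/2]\<close> and \<open>\<integral> ln (c + \<surd>(1 - 3 c\<^sup>2)) ds\<close> over \<open>[2\<pi>/3, \<pi>]\<close>.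
  Both have antiderivatives in the Clausen function \<open>Cl x = D(exp (i x))\<close>, whose derivative is
  \<open>- ln (2 sin (x / 2))\<close>. For the second integral put \<open>s = 2 (t + \<pi>/3)\<close> and let \<open>w\<close> be minus the large root;
  with \<open>b = arctan (2 sin t / w)\<close> one has
  \<open>w = 2 sin t cos b / sin b = 2 sin t cos (b - t + \<pi>/3) / sin (b - t)\<close>, hence
  \<open>ln w dt = ln w db - ln w d(b - t)\<close>, with the two expressions for \<open>w\<close> inserted in turn,
  is a sum of terms \<open>ln (2 sin u) du\<close>. The total
  \<open>2 Cl(\<pi>/2) - Cl(\<pi>/6) + Cl(5\<pi>/6)\<close> reduces to the claim by the duplication formula of \<open>Cl\<close>.
\<close>

subsection \<open>The Clausen function\<close>

lemma open_Ln_domain: "open {z :: complex. 1 - z \<notin> \<real>\<^sub>\<le>\<^sub>0}"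
proof -
  have "open ((\<lambda>z. 1 - z) -` (- \<real>\<^sub>\<le>\<^sub>0 :: complex set))"
    by (intro open_vimage continuous_intros) auto
  then show ?thesis
    by (simp add: vimage_def)
qed

text \<open>The plane cut along [1, \<infinity>) is star-shaped about 0: if u z with 0 \<le> u \<le>
  1 lies on the cut, then z lies on it as well.\<close>

lemma closed_segment_Ln_domain:
  fixes z :: complex
  assumes "1 - z \<notin> \<real>\<^sub>\<le>\<^sub>0" and "w \<in> closed_segment 0 z"
  shows "1 - w \<notin> \<real>\<^sub>\<le>\<^sub>0"
proof
  assume w: "1 - w \<in> \<real>\<^sub>\<le>\<^sub>0"
  obtain u where u: "0 \<le> u" "u \<le> 1" "w = u *\<^sub>R z"
    using assms(2) by (auto simp: in_segment)
  have "Im w = 0" "Re w \<ge> 1"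
    using w by (auto simp: complex_nonpos_Reals_iff)
  then have "u * Im z = 0" "u * Re z \<ge> 1"
    using u by auto
  moreover from this have "u > 0"
    using u(1) by (cases "u = 0") auto
  ultimately have "Im z = 0" "u * Re z \<ge> 1" "Re z > 0"
    using zero_less_mult_pos[of u "Re z"] by auto
  moreover from this have "u * Re z \<le> Re z"
    using u(2) by (intro mult_left_le_one_le) (use u(1) in auto)
  ultimately have "Im z = 0" "Re z \<ge> 1"
    by auto
  then show False
    using assms(1) by (simp add: complex_nonpos_Reals_iff)
qed

text \<open>Once the singularity at 0 is removed, the integrand is holomorphic on a star-shaped
  domain and so has a primitive g; there \<open>dilog\<close> is g(0) - g.\<close>

lemma has_field_derivative_dilog:
  assumes z: "1 - z \<notin> \<real>\<^sub>\<le>\<^sub>0"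
  shows "(dilog has_field_derivative (if z = 0 then 1 else - Ln (1 - z) / z)) (at z)"
proof -
  define S :: "complex set" where "S = {z. 1 - z \<notin> \<real>\<^sub>\<le>\<^sub>0}"
  \<comment> \<open>The value -1 is the derivative of Ln (1 - t) at 0, which makes f the holomorphic
    extension of the quotient.\<close>
  define f :: "complex \<Rightarrow> complex" where "f = (\<lambda>t. if t = 0 then -1 else Ln (1 - t) / t)"
  have S: "open S" unfolding S_def by (rule open_Ln_domain)
  have f: "f holomorphic_on S"
  proof (rule pole_theorem_open_0[where g = "\<lambda>t. Ln (1 - t)" and a = 0])
    show "(\<lambda>t. Ln (1 - t)) holomorphic_on S"
      by (intro holomorphic_intros) (auto simp: S_def)
    have "((\<lambda>t. Ln (1 - t)) has_field_derivative -1) (at 0)"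
      by (auto intro!: derivative_eq_intros)
    then show "f 0 = deriv (\<lambda>t. Ln (1 - t)) 0"
      by (simp add: f_def DERIV_imp_deriv)
  qed (use S in \<open>auto simp: f_def\<close>)
  have star: "closed_segment 0 w \<subseteq> S" if "w \<in> S" for w
    using that closed_segment_Ln_domain unfolding S_def by blast
  have "starlike S"
    unfolding starlike_def using star by (intro bexI[of _ 0]) (auto simp: S_def)
  then obtain g where g: "\<And>w. w \<in> S \<Longrightarrow> (g has_field_derivative f w) (at w)"
    using holomorphic_starlike_primitive[of S f "{}"] S f
    by (auto simp: holomorphic_on_imp_continuous_on holomorphic_on_imp_differentiable_at)
  have dilog: "dilog w = g 0 - g w" if w: "w \<in> S" for w
  proof -
    have "(f has_contour_integral g w - g 0) (linepath 0 w)"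
      using contour_integral_primitive[of S g f "linepath 0 w"] g star[OF w]
      by (auto simp: has_field_derivative_at_within)
    then have "((\<lambda>x. f (linepath 0 w x) * (w - 0)) has_integral (g w - g 0)) {0..1}"
      by (simp only: has_contour_integral_linepath)
    \<comment> \<open>For w \<noteq> 0 the path meets 0 only at parameter 0; for w = 0 the factor w
      - 0 makes both integrands vanish.\<close>
    then have "((\<lambda>x. Ln (1 - linepath 0 w x) / linepath 0 w x * (w - 0))
        has_integral (g w - g 0)) {0..1}"
      by (rule has_integral_spike_finite[rotated 2, where S = "{0}"])
        (auto simp: f_def linepath_def)
    then have "((\<lambda>t. Ln (1 - t) / t) has_contour_integral (g w - g 0)) (linepath 0 w)"
      by (simp only: has_contour_integral_linepath)
    then show ?thesis
      by (simp add: dilog_def contour_integral_unique)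
  qed
  have "z \<in> S" using z by (simp add: S_def)
  have "((\<lambda>w. g 0 - g w) has_field_derivative - f z) (at z)"
    using g[OF \<open>z \<in> S\<close>] by (auto intro!: derivative_eq_intros)
  then have "(dilog has_field_derivative - f z) (at z)"
    by (rule has_field_derivative_transform_within_open[OF _ S \<open>z \<in> S\<close>]) (simp add: dilog)
  then show ?thesis
    by (simp add: f_def split: if_splits)
qed

text \<open>Along the real axis below 1 the derivative of \<open>dilog\<close> is real, so the
  imaginary part keeps its value 0 from the origin.\<close>

lemma Im_dilog_of_real:
  assumes "r < 1"
  shows "Im (dilog (of_real r)) = 0"
proof -
  have "((\<lambda>s. Im (dilog (of_real s))) has_real_derivative 0) (at s within {..<1})"
    if s: "s < 1" for s :: real
  proof -
    have "(dilog has_field_derivative (if s = 0 then 1 else - Ln (1 - of_real s) / of_real s))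
        (at (of_real s))"
      using has_field_derivative_dilog[of "of_real s"] s
      by (simp add: complex_nonpos_Reals_iff)
    from has_field_derivative_Im[OF has_vector_derivative_real_field[OF this]]
    have "((\<lambda>s. Im (dilog (of_real s))) has_real_derivative
        Im (if s = 0 then 1 else - Ln (1 - of_real s) / of_real s)) (at s within {..<1})" .
    moreover have "Im (Ln (1 - of_real s)) = 0"
      using s by (metis Ln_of_real Im_complex_of_real diff_gt_0_iff_gt of_real_1 of_real_diff)
    ultimately show ?thesis
      by (simp add: Im_divide_of_real split: if_splits)
  qed
  then obtain c where c: "\<And>s. s < 1 \<Longrightarrow> Im (dilog (of_real s)) = c"
    using has_field_derivative_zero_constant[of "{..<1::real}" "\<lambda>s. Im (dilog (of_real s))"]
    by (auto simp: convex_real_interval)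
  from c[of 0] c[of r] assms show ?thesis
    by (simp add: dilog_def)
qed

text \<open>In the radial direction the factor z of the chain rule cancels against the denominator.
  What remains is an argument divided by r, which is bounded for r away from 0.\<close>

lemma radial_derivative_dilog:
  assumes "1 - of_real r * z \<notin> \<real>\<^sub>\<le>\<^sub>0" "z \<noteq> 0" "r \<noteq> 0"
  shows "((\<lambda>r. Im (dilog (of_real r * z))) has_real_derivative
           - Im (Ln (1 - of_real r * z)) / r) (at r)"
proof -
  have "(dilog has_field_derivative - Ln (1 - of_real r * z) / (of_real r * z)) (at (of_real r * z))"
    using has_field_derivative_dilog[of "of_real r * z"] assms by simp
  moreover have "((\<lambda>u. u * z) has_field_derivative z) (at (of_real r))"
    by (auto intro!: derivative_eq_intros)
  ultimately have "((\<lambda>u. dilog (u * z)) has_field_derivative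
       - Ln (1 - of_real r * z) / (of_real r * z) * z) (at (of_real r))"
    by (rule DERIV_chain2)
  then have "((\<lambda>u. dilog (u * z)) has_field_derivative
       - Ln (1 - of_real r * z) / of_real r) (at (of_real r))"
    using assms(2) by simp
  from has_field_derivative_Im[OF has_vector_derivative_real_field[OF this]] show ?thesis
    by (simp add: Im_divide_of_real)
qed

section \<open>The Bloch-Wigner function on the unit circle\<close>

definition clausen :: "real \<Rightarrow> real" where
  "clausen x = bloch_wigner (cis x)"

text \<open>The circle meets the cut only at 1, and ln |z| = 0 on it removes the second term of the
  Bloch-Wigner function.\<close>

lemma clausen_eq_Im_dilog:
  assumes "cis x \<noteq> 1"
  shows "clausen x = Im (dilog (cis x))"
proof -
  have "\<not> (cis x \<in> \<real> \<and> Re (cis x) \<ge> 1)"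
  proof
    assume *: "cis x \<in> \<real> \<and> Re (cis x) \<ge> 1"
    then have "Im (cis x) = 0" "Re (cis x) = 1"
      using abs_Re_le_cmod[of "cis x"] by (auto simp: complex_is_Real_iff simp del: cis.sel)
    then show False
      using assms by (simp add: complex_eq_iff)
  qed
  then show ?thesis
    unfolding clausen_def bloch_wigner_def by (subst if_not_P) simp_all
qed

lemma clausen_0: "clausen 0 = 0"
  by (simp add: clausen_def bloch_wigner_def)

lemma clausen_pi: "clausen pi = 0"
  using Im_dilog_of_real[of "-1"] clausen_eq_Im_dilog[of pi] by simp

lemma cos_less_one:
  fixes x :: real
  assumes "0 < x" "x < 2 * pi"
  shows "cos x < 1"
proof -
  have "sin (x / 2) > 0"
    using assms by (intro sin_gt_zero) auto
  moreover have "cos x = 1 - 2 * (sin (x / 2))\<^sup>2"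
    using cos_double_sin[of "x / 2"] by simp
  ultimately show ?thesis by simp
qed

lemma cmod_one_minus_cis:
  assumes "0 \<le> x" "x \<le> 2 * pi"
  shows "cmod (1 - cis x) = 2 * sin (x / 2)"
proof -
  have "(cmod (1 - cis x))\<^sup>2 = (1 - cos x)\<^sup>2 + (sin x)\<^sup>2"
    by (simp add: cmod_power2)
  also have "\<dots> = 2 * (1 - cos x)"
    using sin_cos_squared_add[of x] by (simp add: power2_eq_square algebra_simps)
  also have "\<dots> = (2 * sin (x / 2))\<^sup>2"
    using cos_double_sin[of "x / 2"] by (simp add: power2_eq_square)
  finally show ?thesis
    by (rule power2_eq_imp_eq) (use assms in \<open>simp_all add: sin_ge_zero\<close>)
qed

text \<open>By the chain rule Li2(exp (i x)) has derivative -i Ln (1 - exp (i x)), whose imaginary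
  part is minus the logarithm of the chord length 2 sin (x / 2).\<close>

lemma has_real_derivative_clausen:
  assumes x: "0 < x" "x < 2 * pi"
  shows "(clausen has_real_derivative - ln (2 * sin (x / 2))) (at x)"
proof -
  have dom: "1 - cis x \<notin> \<real>\<^sub>\<le>\<^sub>0"
    using cos_less_one[OF x] by (simp add: complex_nonpos_Reals_iff)
  have d: "(dilog has_field_derivative - Ln (1 - exp (\<i> * of_real x)) / exp (\<i> * of_real x))
      (at (exp (\<i> * of_real x)))"
    using has_field_derivative_dilog[OF dom] by (simp add: cis_conv_exp)
  have e: "((\<lambda>u. exp (\<i> * u)) has_field_derivative exp (\<i> * of_real x) * \<i>) (at (of_real x))"
    by (auto intro!: derivative_eq_intros)
  have "((\<lambda>u. dilog (exp (\<i> * u))) has_field_derivative - (\<i> * Ln (1 - cis x))) (at (of_real x))"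
    using DERIV_chain2[OF d e] by (simp add: cis_conv_exp mult.commute)
  from has_field_derivative_Im[OF has_vector_derivative_real_field[OF this]]
  have "((\<lambda>u. Im (dilog (cis u))) has_real_derivative - Re (Ln (1 - cis x))) (at x)"
    by (simp add: cis_conv_exp)
  moreover have "Re (Ln (1 - cis x)) = ln (2 * sin (x / 2))"
    using dom cmod_one_minus_cis[of x] x by (subst Re_Ln) auto
  ultimately have "((\<lambda>u. Im (dilog (cis u))) has_real_derivative - ln (2 * sin (x / 2))) (at x)"
    by simp
  then show ?thesis
  proof (rule has_field_derivative_transform_within_open[where S = "{0<..<2 * pi}"])
    fix u assume "u \<in> {0<..<2 * pi}"
    then have "cos u < 1" by (auto intro: cos_less_one)
    then have "cis u \<noteq> 1" by (auto simp: complex_eq_iff)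
    then show "Im (dilog (cis u)) = clausen u" by (simp add: clausen_eq_Im_dilog)
  qed (use x in auto)
qed

text \<open>
  The imaginary part of the logarithm is bounded, so \<open>Im (dilog (r z))\<close> is Lipschitz in \<open>r\<close>
  near \<open>r = 1\<close>, uniformly in \<open>z\<close>.
\<close>
lemma tendsto_clausen_0: "(clausen \<longlongrightarrow> 0) (at_right 0)"
proof (rule tendstoI)
  fix e :: real assume e: "e > 0"
  \<comment> \<open>With this r the Lipschitz bound (1 - r) 2 pi stays below e / 2. The constant 2
    pi is pi / s for s \<ge> 1 / 2.\<close>
  define r where "r = 1 - min (1 / 2) (e / (8 * pi))"
  have r: "1 / 2 \<le> r" "r < 1" "(1 - r) * (2 * pi) < e / 2"
    using e by (auto simp: r_def min_def field_simps)
  have "isCont dilog (of_real r)"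
    using has_field_derivative_dilog[of "of_real r"] r
    by (intro DERIV_isCont) (auto simp: complex_nonpos_Reals_iff)
  then have "((\<lambda>x. Im (dilog (of_real r * cis x))) \<longlongrightarrow> Im (dilog (of_real r * cis 0))) (at_right 0)"
    by (intro tendsto_Im isCont_tendsto_compose[where g = dilog] tendsto_mult tendsto_cis) (auto intro!: tendsto_eq_intros)
  then have "eventually (\<lambda>x. dist (Im (dilog (of_real r * cis x))) 0 < e / 2) (at_right 0)"
    using e r by (intro tendstoD) (auto simp: Im_dilog_of_real)
  moreover have "eventually (\<lambda>x. x \<in> {0<..<2 * pi}) (at_right (0::real))"
    by (rule eventually_at_right_real) simp
  ultimately show "eventually (\<lambda>x. dist (clausen x) 0 < e) (at_right 0)"
  proof eventually_elim
    case (elim x)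
    have c: "cos x < 1"
      using elim by (intro cos_less_one) auto
    then have "cis x \<noteq> 1" by (auto simp: complex_eq_iff)
    have dom: "1 - of_real s * cis x \<notin> \<real>\<^sub>\<le>\<^sub>0" if "0 < s" "s \<le> 1" for s
    proof -
      have "s * cos x < 1"
      proof (cases "cos x \<le> 0")
        case True
        then have "s * cos x \<le> 0"
          using that by (simp add: mult_nonneg_nonpos)
        then show ?thesis by simp
      next
        case False
        then have "s * cos x \<le> cos x"
          using that by simp
        then show ?thesis using c by simp
      qed
      then show ?thesis by (simp add: complex_nonpos_Reals_iff)
    qed
    have "\<exists>s. r < s \<and> s < 1 \<and> Im (dilog (of_real 1 * cis x)) - Im (dilog (of_real r * cis x)) =
        (1 - r) * (- Im (Ln (1 - of_real s * cis x)) / s)"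
      using r by (intro MVT2 radial_derivative_dilog dom) auto
    then obtain s where s: "r < s" "s < 1"
      and eq: "Im (dilog (cis x)) - Im (dilog (of_real r * cis x)) =
        (1 - r) * (- Im (Ln (1 - of_real s * cis x)) / s)" by auto
    have "1 - of_real s * cis x \<noteq> 0"
      using dom[of s] s r by auto
    then have "\<bar>Im (Ln (1 - of_real s * cis x))\<bar> \<le> pi"
      using mpi_less_Im_Ln[of "1 - of_real s * cis x"] Im_Ln_le_pi[of "1 - of_real s * cis x"]
        by (auto simp: abs_le_iff)
    also have "pi \<le> pi * (2 * s)"
      using s r by simp
    finally have "\<bar>- Im (Ln (1 - of_real s * cis x)) / s\<bar> \<le> 2 * pi"
      using s r by (simp add: abs_divide pos_divide_le_eq mult_ac)
    then have "\<bar>Im (dilog (cis x)) - Im (dilog (of_real r * cis x))\<bar> \<le> (1 - r) * (2 * pi)"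
      unfolding eq abs_mult using r by (intro mult_mono) auto
    then show ?case
      using elim r \<open>cis x \<noteq> 1\<close> by (simp add: clausen_eq_Im_dilog dist_real_def)
  qed
qed

text \<open>The point 0 is included, although the derivative is unbounded there, because Clausen
  antiderivatives are later evaluated at it.\<close>

lemma continuous_on_clausen: "continuous_on {0..<2 * pi} clausen"
  unfolding continuous_on_def
proof
  fix x assume x: "x \<in> {0..<2 * pi}"
  show "(clausen \<longlongrightarrow> clausen x) (at x within {0..<2 * pi})"
  proof (cases "x = 0")
    case True
    have "(clausen \<longlongrightarrow> 0) (at 0 within {0..<2 * pi})"
      by (rule tendsto_mono[OF _ tendsto_clausen_0]) (auto simp: at_within_def intro!: inf.coboundedI2 inf_greatest)
    then show ?thesis using True by (simp add: clausen_0)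
  next
    case False
    then have "isCont clausen x"
      using x by (intro DERIV_isCont[OF has_real_derivative_clausen]) auto
    then show ?thesis
      unfolding isCont_def by (rule tendsto_within_subset) simp
  qed
qed

section \<open>Reflection and duplication formulas\<close>

lemma clausen_two_pi_minus:
  assumes "0 < x" "x < 2 * pi"
  shows "clausen (2 * pi - x) = - clausen x"
proof -
  have "((\<lambda>x. clausen (2 * pi - x) + clausen x) has_real_derivative 0) (at u within {0<..<2 * pi})"
    if u: "u \<in> {0<..<2 * pi}" for u
  proof -
    have "((\<lambda>x. clausen (2 * pi - x)) has_real_derivative
        - ln (2 * sin ((2 * pi - u) / 2)) * (-1)) (at u)"
      using u by (intro DERIV_chain2[OF has_real_derivative_clausen])
        (auto intro!: derivative_eq_intros)
    moreover have "sin ((2 * pi - u) / 2) = sin (u / 2)"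
      by (simp add: diff_divide_distrib sin_diff)
    ultimately have "((\<lambda>x. clausen (2 * pi - x) + clausen x) has_real_derivative 0) (at u)"
      using has_real_derivative_clausen[of u] u by (auto intro!: derivative_eq_intros)
    then show ?thesis
      by (rule has_field_derivative_at_within)
  qed
  then obtain c where c: "\<And>u. u \<in> {0<..<2 * pi} \<Longrightarrow> clausen (2 * pi - u) + clausen u = c"
    using has_field_derivative_zero_constant[of "{0<..<2 * pi}" "\<lambda>x. clausen (2 * pi - x) + clausen x"]
    by auto
  \<comment> \<open>The constant is read off at pi, where both summands vanish.\<close>
  from c[of pi] c[of x] assms show ?thesis
    by (simp add: clausen_pi)
qed

text \<open>Differentiation turns the claim into 2 sin u = 2 sin (u / 2) 2 cos (u / 2). The constant
  is found at pi / 2, where the right side cancels and the left side is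
  \<open>clausen pi\<close>.\<close>

lemma clausen_double:
  assumes "0 < x" "x < pi"
  shows "clausen (2 * x) = 2 * clausen x - 2 * clausen (pi - x)"
proof -
  let ?f = "\<lambda>x. clausen (2 * x) - 2 * clausen x + 2 * clausen (pi - x)"
  have "(?f has_real_derivative 0) (at u within {0<..<pi})" if u: "u \<in> {0<..<pi}" for u
  proof -
    have pos: "sin (u / 2) > 0" "cos (u / 2) > 0"
      using u by (simp_all add: sin_gt_zero cos_gt_zero)
    have "((\<lambda>x. clausen (2 * x)) has_real_derivative - ln (2 * sin (2 * u / 2)) * 2) (at u)"
      using u by (intro DERIV_chain2[OF has_real_derivative_clausen])
        (auto intro!: derivative_eq_intros)
    moreover have "((\<lambda>x. clausen (pi - x)) has_real_derivative
        - ln (2 * sin ((pi - u) / 2)) * (-1)) (at u)"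
      using u by (intro DERIV_chain2[OF has_real_derivative_clausen])
        (auto intro!: derivative_eq_intros)
    moreover have half: "sin ((pi - u) / 2) = cos (u / 2)"
      by (simp add: diff_divide_distrib sin_diff)
    moreover have double: "ln (2 * sin u) = ln (2 * sin (u / 2)) + ln (2 * cos (u / 2))"
      using pos sin_double[of "u / 2"] ln_mult[of "2 * sin (u / 2)" "2 * cos (u / 2)"]
      by (simp add: mult_ac)
    moreover have "(clausen has_real_derivative - ln (2 * sin (u / 2))) (at u)"
      using u by (intro has_real_derivative_clausen) auto
    ultimately have "(?f has_real_derivative - ln (2 * sin (2 * u / 2)) * 2
        - 2 * - ln (2 * sin (u / 2)) + 2 * (- ln (2 * sin ((pi - u) / 2)) * (-1))) (at u)"
      by (intro DERIV_add DERIV_diff DERIV_cmult)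
    then have "(?f has_real_derivative 0) (at u)"
      by (simp add: half double)
    then show ?thesis
      by (rule has_field_derivative_at_within)
  qed
  then obtain c where c: "\<And>u. u \<in> {0<..<pi} \<Longrightarrow> ?f u = c"
    using has_field_derivative_zero_constant[of "{0<..<pi}" ?f] by auto
  from c[of "pi / 2"] c[of x] assms show ?thesis
    by (simp add: clausen_pi)
qed

subsection \<open>Two logarithmic integrals\<close>

lemma has_real_derivative_clausen_compose:
  assumes "(g has_real_derivative g') (at x)" "0 < g x" "g x < 2 * pi"
  shows "((\<lambda>x. clausen (g x)) has_real_derivative - ln (2 * sin (g x / 2)) * g') (at x)"
  using DERIV_chain2[OF has_real_derivative_clausen assms(1)] assms(2,3) .

lemma continuous_on_clausen_compose:
  assumes "continuous_on S g" "\<And>x. x \<in> S \<Longrightarrow> 0 \<le> g x \<and> g x < 2 * pi"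
  shows "continuous_on S (\<lambda>x. clausen (g x))"
  by (rule continuous_on_compose2[OF continuous_on_clausen assms(1)])
    (simp add: image_subset_iff assms(2))

text \<open>The factorisation 1 + 2 cos s = 2 sin (s / 2 + pi / 3) 2 sin (s / 2 + 2 pi / 3) splits
  the integrand into two Clausen derivatives.\<close>

lemma has_integral_ln_one_plus_two_cos:
  "((\<lambda>s. ln (1 + 2 * cos s)) has_integral clausen (pi / 6) + clausen (5 * pi / 6)) {0..pi / 2}"
proof -
  let ?F = "\<lambda>s. - clausen (s + 2 * pi / 3) - clausen (s + 4 * pi / 3)"
  have "(?F has_real_derivative ln (1 + 2 * cos s)) (at s within {0..pi / 2})"
    if s: "0 \<le> s" "s \<le> pi / 2" for s
  proof -
    have pos: "sin ((s + 2 * pi / 3) / 2) > 0" "sin ((s + 4 * pi / 3) / 2) > 0"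
      by (rule sin_gt_zero; use s pi_gt_zero in argo)+
    have "((\<lambda>s. clausen (s + 2 * pi / 3)) has_real_derivative
        - ln (2 * sin ((s + 2 * pi / 3) / 2)) * 1) (at s)"
      by (rule has_real_derivative_clausen_compose)
        ((auto intro!: derivative_eq_intros; fail) | (use s pi_gt_zero in argo))+
    moreover have "((\<lambda>s. clausen (s + 4 * pi / 3)) has_real_derivative
        - ln (2 * sin ((s + 4 * pi / 3) / 2)) * 1) (at s)"
      by (rule has_real_derivative_clausen_compose)
        ((auto intro!: derivative_eq_intros; fail) | (use s pi_gt_zero in argo))+
    ultimately have "(?F has_real_derivative - (- ln (2 * sin ((s + 2 * pi / 3) / 2)) * 1)
        - (- ln (2 * sin ((s + 4 * pi / 3) / 2)) * 1)) (at s)"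
      by (intro DERIV_diff DERIV_minus)
    moreover have "2 * sin ((s + 2 * pi / 3) / 2) * (2 * sin ((s + 4 * pi / 3) / 2)) = 1 + 2 * cos s"
    proof -
      have "(s + 2 * pi / 3) / 2 - (s + 4 * pi / 3) / 2 = - (pi / 3)"
        "(s + 2 * pi / 3) / 2 + (s + 4 * pi / 3) / 2 = s + pi"
        by (simp_all add: field_simps)
      then show ?thesis
        using sin_times_sin[of "(s + 2 * pi / 3) / 2" "(s + 4 * pi / 3) / 2"]
        by (simp add: cos_60)
    qed
    then have "ln (2 * sin ((s + 2 * pi / 3) / 2)) + ln (2 * sin ((s + 4 * pi / 3) / 2))
        = ln (1 + 2 * cos s)"
      using pos ln_mult[of "2 * sin ((s + 2 * pi / 3) / 2)" "2 * sin ((s + 4 * pi / 3) / 2)"] by simp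
    ultimately have "(?F has_real_derivative ln (1 + 2 * cos s)) (at s)"
      by simp
    then show ?thesis
      by (rule has_field_derivative_at_within)
  qed
  then have "((\<lambda>s. ln (1 + 2 * cos s)) has_integral ?F (pi / 2) - ?F 0) {0..pi / 2}"
    by (intro fundamental_theorem_of_calculus)
      (auto simp: has_real_derivative_iff_has_vector_derivative)
  \<comment> \<open>Reflection brings the endpoint arguments into (0, pi). At s = 0 the two terms
    are opposite and cancel.\<close>
  moreover have "pi / 2 + 2 * pi / 3 = 2 * pi - 5 * pi / 6" "pi / 2 + 4 * pi / 3 = 2 * pi - pi / 6"
    "0 + 4 * pi / 3 = 2 * pi - 2 * pi / 3"
    by simp_all
  ultimately show ?thesis
    using clausen_two_pi_minus[of "5 * pi / 6"] clausen_two_pi_minus[of "pi / 6"]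
      clausen_two_pi_minus[of "2 * pi / 3"] by (simp only:) (simp add: add.commute)
qed

text \<open>
  Minus the larger root in absolute value of the quadratic, in the variable \<open>t = s / 2 - \<pi> / 3\<close>.
\<close>
definition large_root :: "real \<Rightarrow> real" where
  "large_root t = cos (t + pi / 3) + sqrt (1 - 3 * (cos (t + pi / 3))\<^sup>2)"

text \<open>The angle opposite the leg 2 sin t in a right triangle whose other leg is the large
  root.\<close>

definition root_angle :: "real \<Rightarrow> real" where
  "root_angle t = arctan (2 * sin t / large_root t)"

section \<open>The large root, its angle and its logarithmic integral\<close>

lemma cos_plus_third_pi_bounds:
  assumes "0 \<le> t" "t \<le> pi / 6"
  shows "0 \<le> cos (t + pi / 3)" "cos (t + pi / 3) \<le> 1 / 2" "(cos (t + pi / 3))\<^sup>2 \<le> 1 / 4"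
proof -
  show 0: "0 \<le> cos (t + pi / 3)"
    using assms by (intro cos_ge_zero) auto
  have "cos (t + pi / 3) \<le> cos (pi / 3)"
    using assms by (intro cos_monotone_0_pi_le) auto
  then show 1: "cos (t + pi / 3) \<le> 1 / 2"
    by (simp add: cos_60)
  show "(cos (t + pi / 3))\<^sup>2 \<le> 1 / 4"
    using power_mono[OF 1 0, of 2] by (simp add: power2_eq_square)
qed

text \<open>The upper bound is what makes \<open>root_angle t\<close> exceed t for t > 0. Since the
  square root is at most 1, the large root is at most cos t / 2 + 1, and 3 / 2 cos t > 1 on this
  range.\<close>

lemma large_root_bounds:
  assumes t: "0 \<le> t" "t \<le> pi / 6"
  shows "0 < large_root t" "large_root t < 2 * cos t"
proof -
  note c = cos_plus_third_pi_bounds[OF t]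
  have "sqrt (1 - 3 * (cos (t + pi / 3))\<^sup>2) > 0"
    using c by simp
  then show "0 < large_root t"
    unfolding large_root_def using c by (intro add_nonneg_pos)
  have "cos t \<ge> cos (pi / 6)"
    using t by (intro cos_monotone_0_pi_le) auto
  moreover have "sqrt 3 > 1.7"
    by (rule real_less_rsqrt) (simp add: power2_eq_square)
  ultimately have "3 / 2 * cos t > 1"
    by (simp add: cos_30)
  moreover have "sqrt (1 - 3 * (cos (t + pi / 3))\<^sup>2) \<le> 1"
    by simp
  moreover have "sqrt 3 * sin t \<ge> 0"
    using t by (intro mult_nonneg_nonneg sin_ge_zero) auto
  moreover have "cos (t + pi / 3) = cos t / 2 - sqrt 3 * sin t / 2"
    by (simp add: cos_add cos_60 sin_60)
  ultimately show "large_root t < 2 * cos t"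
    unfolding large_root_def by linarith
qed

lemma large_root_quadratic:
  assumes "0 \<le> t" "t \<le> pi / 6"
  shows "(large_root t)\<^sup>2 = 2 * cos (t + pi / 3) * large_root t - (4 * (cos (t + pi / 3))\<^sup>2 - 1)"
proof -
  have "(sqrt (1 - 3 * (cos (t + pi / 3))\<^sup>2))\<^sup>2 = 1 - 3 * (cos (t + pi / 3))\<^sup>2"
    using cos_plus_third_pi_bounds[OF assms] by simp
  then show ?thesis
    unfolding large_root_def by (simp add: power2_eq_square algebra_simps)
qed

text \<open>The first identity is the definition of the angle with denominators cleared. The second
  is the quadratic equation of the large root, rewritten with the first.\<close>

lemma root_angle_identities:
  assumes t: "0 < t" "t \<le> pi / 6"
  shows "large_root t * sin (root_angle t) = 2 * sin t * cos (root_angle t)"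
    and "large_root t * sin (root_angle t - t) = 2 * sin t * cos (root_angle t - t + pi / 3)"
proof -
  define w b s c where defs: "w = large_root t" "b = root_angle t" "s = sin t" "c = cos t"
  have w: "w > 0"
    using large_root_bounds[of t] t by (simp add: defs)
  have "cos b > 0"
    by (simp add: defs root_angle_def cos_arctan add_pos_nonneg)
  have "tan b = 2 * s / w"
    by (simp add: defs root_angle_def tan_arctan)
  then have sin_b: "w * sin b = 2 * s * cos b"
    using w \<open>cos b > 0\<close> by (simp add: tan_def field_simps)
  then show "large_root t * sin (root_angle t) = 2 * sin t * cos (root_angle t)"
    by (simp add: defs)
  have cos3: "cos (t + pi / 3) = c / 2 - sqrt 3 / 2 * s"
    by (simp add: defs cos_add cos_60 sin_60)
  have "s\<^sup>2 = 1 - c\<^sup>2"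
    by (simp add: defs sin_squared_eq)
  have quad: "w\<^sup>2 = (c - sqrt 3 * s) * w - ((c - sqrt 3 * s)\<^sup>2 - 1)"
    using large_root_quadratic[of t] t unfolding cos3 by (simp add: defs power2_eq_square field_simps)
  \<comment> \<open>The additional factor w produces w^2, to which the quadratic applies; it is
    cancelled at the end.\<close>
  have "w * (w * sin (b - t)) = w * (w * sin b * c - w * cos b * s)"
    by (simp add: defs sin_diff algebra_simps)
  also have "\<dots> = s * cos b * (2 * w * c - w\<^sup>2)"
    unfolding sin_b by (simp add: power2_eq_square algebra_simps)
  also have "\<dots> = s * cos b * (w * (c + sqrt 3 * s) + ((c - sqrt 3 * s)\<^sup>2 - 1))"
    unfolding quad by (simp add: algebra_simps)
  also have "(c - sqrt 3 * s)\<^sup>2 - 1 = 2 * s * (s - sqrt 3 * c)"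
    using \<open>s\<^sup>2 = 1 - c\<^sup>2\<close> by (simp add: power2_eq_square algebra_simps)
  also have "s * cos b * (w * (c + sqrt 3 * s) + 2 * s * (s - sqrt 3 * c)) =
      s * (w * cos b * (c + sqrt 3 * s) + (2 * s * cos b) * (s - sqrt 3 * c))"
    by (simp add: algebra_simps)
  also have "\<dots> = w * (s * (cos b * (c + sqrt 3 * s) + sin b * (s - sqrt 3 * c)))"
    unfolding sin_b[symmetric] by (simp add: algebra_simps)
  also have "s * (cos b * (c + sqrt 3 * s) + sin b * (s - sqrt 3 * c)) = 2 * s * cos (b - t + pi / 3)"
    by (simp add: defs cos_add cos_diff sin_diff sin_add cos_60 sin_60 algebra_simps)
  finally show "large_root t * sin (root_angle t - t) = 2 * sin t * cos (root_angle t - t + pi / 3)"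
    using w by (simp add: defs)
qed

lemma root_angle_0: "root_angle 0 = 0"
  by (simp add: root_angle_def)

text \<open>These bounds make the sines and cosines in the two identities positive, so that
  logarithms may be taken. The last two follow from the second identity: sin (b - t) > 0 forces its
  cosine to be positive.\<close>

lemma root_angle_bounds:
  assumes t: "0 < t" "t \<le> pi / 6"
  shows "t < root_angle t" "root_angle t < pi / 2" "root_angle t - t < pi / 6"
    "cos (root_angle t - t + pi / 3) > 0"
proof -
  note w = large_root_bounds[of t]
  have sin: "sin t > 0" and cos: "cos t > 0"
    using t by (auto intro!: sin_gt_zero cos_gt_zero)
  have "tan t < 2 * sin t / large_root t"
    using w t sin cos by (simp add: tan_def field_simps)
  then have "arctan (tan t) < root_angle t"
    unfolding root_angle_def by (rule arctan_monotone)
  then show b: "t < root_angle t"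
    using t by (simp add: arctan_tan)
  show b2: "root_angle t < pi / 2"
    unfolding root_angle_def by (rule arctan_ubound)
  have "sin (root_angle t - t) > 0"
    using b b2 t by (intro sin_gt_zero) auto
  then have "2 * sin t * cos (root_angle t - t + pi / 3) > 0"
    using root_angle_identities(2)[OF t] w(1) t by (metis less_eq_real_def mult_pos_pos)
  then show pos: "cos (root_angle t - t + pi / 3) > 0"
    using sin by (simp add: zero_less_mult_iff)
  show "root_angle t - t < pi / 6"
  proof (rule ccontr)
    assume "\<not> root_angle t - t < pi / 6"
    \<comment> \<open>Otherwise the angle b - t + pi / 3 would be at least pi / 2 and less than 3 pi
      / 2, where the cosine is not positive.\<close>
    then have "sin (root_angle t - t + pi / 3 - pi / 2) \<ge> 0"
      using b2 t by (intro sin_ge_zero) auto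
    then show False
      using pos sin_diff[of "root_angle t - t + pi / 3" "pi / 2"] by simp
  qed
qed

text \<open>Logarithms of the two angle identities. Both differences have the same value, so a
  combination of them with weights b' and 1 - b' has that value too.\<close>

lemma ln_large_root:
  assumes t: "0 < t" "t \<le> pi / 6"
  shows "ln (2 * cos (root_angle t)) - ln (2 * sin (root_angle t)) =
           ln (large_root t) - ln (2 * sin t)"
    and "ln (2 * cos (root_angle t - t + pi / 3)) - ln (2 * sin (root_angle t - t)) =
           ln (large_root t) - ln (2 * sin t)"
proof -
  note b = root_angle_bounds[OF t] and w = large_root_bounds[of t]
  have s: "sin t > 0" "sin (root_angle t) > 0" "cos (root_angle t) > 0" "sin (root_angle t - t) > 0"
    using b t by (auto intro!: sin_gt_zero cos_gt_zero)
  have "large_root t * (2 * sin (root_angle t)) = 2 * sin t * (2 * cos (root_angle t))"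
    using root_angle_identities(1)[OF t] by linarith
  then have "ln (large_root t * (2 * sin (root_angle t))) = ln (2 * sin t * (2 * cos (root_angle t)))"
    by (rule arg_cong)
  then show "ln (2 * cos (root_angle t)) - ln (2 * sin (root_angle t)) =
           ln (large_root t) - ln (2 * sin t)"
    using s w(1) t by (simp only: ln_mult_pos mult_pos_pos zero_less_numeral)
  have "large_root t * (2 * sin (root_angle t - t)) =
      2 * sin t * (2 * cos (root_angle t - t + pi / 3))"
    using root_angle_identities(2)[OF t] by linarith
  then have "ln (large_root t * (2 * sin (root_angle t - t))) =
      ln (2 * sin t * (2 * cos (root_angle t - t + pi / 3)))"
    by (rule arg_cong)
  then show "ln (2 * cos (root_angle t - t + pi / 3)) - ln (2 * sin (root_angle t - t)) =
           ln (large_root t) - ln (2 * sin t)"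
    using s b(4) w(1) t by (simp only: ln_mult_pos mult_pos_pos zero_less_numeral)
qed

text \<open>Existence of a derivative b' is enough: it enters only through the weights b' and 1 -
  b', whose sum is 1.\<close>

lemma root_angle_differentiable:
  assumes t: "0 \<le> t" "t \<le> pi / 6"
  obtains b' where "(root_angle has_real_derivative b') (at t)"
proof -
  have "\<exists>b'. (root_angle has_real_derivative b') (at t)"
    unfolding root_angle_def large_root_def
    using large_root_bounds[OF t, unfolded large_root_def] cos_plus_third_pi_bounds[OF t]
    by (intro exI) (rule derivative_eq_intros refl | simp)+
  then show ?thesis
    using that by blast
qed

lemma has_integral_ln_large_root:
  "((\<lambda>t. ln (large_root t)) has_integral clausen (pi / 2) - clausen (pi / 6)) {0..pi / 6}"
proof -
  let ?b = root_angle
  \<comment> \<open>The first term contributes ln (2 sin t), the next two b' times the first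
    difference in \<open>ln_large_root\<close>, the last two 1 - b' times the second. The shift 5 pi
    / 3 turns the halved argument into pi / 2 + (b - t + pi / 3), hence sine into cosine.\<close>
  let ?F = "\<lambda>t. (- clausen (2 * t) + clausen (2 * ?b t) + clausen (pi - 2 * ?b t)
    - clausen (2 * (?b t - t)) + clausen (5 * pi / 3 + 2 * (?b t - t))) / 2"
  have bounds: "0 \<le> ?b t" "?b t < pi / 2" "t \<le> ?b t" "?b t - t < pi / 6"
    if "t \<in> {0..pi / 6}" for t
    using root_angle_bounds[of t] that root_angle_0 by (cases "t = 0"; simp)+
  have "continuous_on {0..pi / 6} ?b"
    by (intro continuous_at_imp_continuous_on ballI)
      (auto intro: root_angle_differentiable DERIV_isCont)
  moreover have "0 \<le> 2 * t \<and> 2 * t < 2 * pi" "0 \<le> 2 * ?b t \<and> 2 * ?b t < 2 * pi"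
    "0 \<le> pi - 2 * ?b t \<and> pi - 2 * ?b t < 2 * pi" "0 \<le> 2 * (?b t - t) \<and> 2 * (?b t - t) < 2 * pi"
    "0 \<le> 5 * pi / 3 + 2 * (?b t - t) \<and> 5 * pi / 3 + 2 * (?b t - t) < 2 * pi"
    if "t \<in> {0..pi / 6}" for t
    by (rule conjI; use that[unfolded atLeastAtMost_iff] bounds[OF that] pi_gt_zero in argo)+
  ultimately have "continuous_on {0..pi / 6} ?F"
    by (intro continuous_on_divide continuous_on_add continuous_on_diff continuous_on_minus
        continuous_on_mult continuous_on_const continuous_on_id continuous_on_clausen_compose) auto
  moreover have "(?F has_vector_derivative ln (large_root t)) (at t)"
    if t: "t \<in> {0<..<pi / 6}" for t
  proof -
    obtain b' where b': "(?b has_real_derivative b') (at t)"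
      using root_angle_differentiable[of t] t by auto
    have b: "0 < t" "t < pi / 6" "t < ?b t" "?b t < pi / 2" "?b t - t < pi / 6" "2 \<le> pi"
      using root_angle_bounds[of t] t pi_ge_two by auto
    have "((\<lambda>t. clausen (2 * t)) has_real_derivative - ln (2 * sin (2 * t / 2)) * 2) (at t)"
      by (rule has_real_derivative_clausen_compose)
        ((auto intro!: derivative_eq_intros b'; fail) | (use b in argo))+
    moreover have "((\<lambda>t. clausen (2 * ?b t)) has_real_derivative
        - ln (2 * sin (2 * ?b t / 2)) * (2 * b')) (at t)"
      by (rule has_real_derivative_clausen_compose)
        ((auto intro!: derivative_eq_intros b'; fail) | (use b in argo))+
    moreover have "((\<lambda>t. clausen (pi - 2 * ?b t)) has_real_derivative
        - ln (2 * sin ((pi - 2 * ?b t) / 2)) * (- 2 * b')) (at t)"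
      by (rule has_real_derivative_clausen_compose)
        ((auto intro!: derivative_eq_intros b'; fail) | (use b in argo))+
    moreover have "((\<lambda>t. clausen (2 * (?b t - t))) has_real_derivative
        - ln (2 * sin (2 * (?b t - t) / 2)) * (2 * (b' - 1))) (at t)"
      by (rule has_real_derivative_clausen_compose)
        ((auto intro!: derivative_eq_intros b'; fail) | (use b in argo))+
    moreover have "((\<lambda>t. clausen (5 * pi / 3 + 2 * (?b t - t))) has_real_derivative
        - ln (2 * sin ((5 * pi / 3 + 2 * (?b t - t)) / 2)) * (2 * (b' - 1))) (at t)"
      by (rule has_real_derivative_clausen_compose)
        ((auto intro!: derivative_eq_intros b'; fail) | (use b in argo))+
    ultimately have "(?F has_real_derivative
        (- (- ln (2 * sin (2 * t / 2)) * 2)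
        + (- ln (2 * sin (2 * ?b t / 2)) * (2 * b'))
        + (- ln (2 * sin ((pi - 2 * ?b t) / 2)) * (- 2 * b'))
        - (- ln (2 * sin (2 * (?b t - t) / 2)) * (2 * (b' - 1)))
        + (- ln (2 * sin ((5 * pi / 3 + 2 * (?b t - t)) / 2)) * (2 * (b' - 1)))) / 2) (at t)"
      by (intro DERIV_add DERIV_diff DERIV_minus DERIV_cdivide)
    moreover have "sin ((pi - 2 * ?b t) / 2) = cos (?b t)"
      by (simp add: diff_divide_distrib sin_diff)
    moreover have "sin ((5 * pi / 3 + 2 * (?b t - t)) / 2) = cos (?b t - t + pi / 3)"
    proof -
      have "(5 * pi / 3 + 2 * (?b t - t)) / 2 = pi / 2 + (?b t - t + pi / 3)"
        by (simp add: field_simps)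
      then show ?thesis
        by (simp only: sin_add) simp
    qed
    ultimately have "(?F has_real_derivative
        (- (- ln (2 * sin t) * 2) + (- ln (2 * sin (?b t)) * (2 * b'))
        + (- ln (2 * cos (?b t)) * (- 2 * b')) - (- ln (2 * sin (?b t - t)) * (2 * (b' - 1)))
        + (- ln (2 * cos (?b t - t + pi / 3)) * (2 * (b' - 1)))) / 2) (at t)"
      by (simp only: nonzero_mult_div_cancel_left[OF zero_neq_numeral[symmetric]])
    moreover have "(- (- s * 2) + (- u * (2 * b')) + (- v * (- 2 * b')) - (- x * (2 * (b' - 1)))
        + (- y * (2 * (b' - 1)))) / 2 = w" if "v - u = w - s" "y - x = w - s" for s u v w x y :: real
    proof -
      have "(- (- s * 2) + (- u * (2 * b')) + (- v * (- 2 * b')) - (- x * (2 * (b' - 1)))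
        + (- y * (2 * (b' - 1)))) / 2 = s + b' * (v - u) + (1 - b') * (y - x)"
        by (simp add: field_simps)
      also have "\<dots> = w"
        unfolding that by (simp add: algebra_simps)
      finally show ?thesis .
    qed
    from this[OF ln_large_root] have "(- (- ln (2 * sin t) * 2) + (- ln (2 * sin (?b t)) * (2 * b'))
        + (- ln (2 * cos (?b t)) * (- 2 * b')) - (- ln (2 * sin (?b t - t)) * (2 * (b' - 1)))
        + (- ln (2 * cos (?b t - t + pi / 3)) * (2 * (b' - 1)))) / 2 = ln (large_root t)"
      using t by simp
    ultimately show ?thesis
      unfolding has_real_derivative_iff_has_vector_derivative[symmetric] by (simp only:)
  qed
  \<comment> \<open>Derivatives in the interior and continuity up to the ends are used, since at t =
    0 three Clausen arguments are 0.\<close>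
  ultimately have "((\<lambda>t. ln (large_root t)) has_integral ?F (pi / 6) - ?F 0) {0..pi / 6}"
    by (intro fundamental_theorem_of_calculus_interior) auto
  \<comment> \<open>At t = pi / 6 the large root and 2 sin t are both 1.\<close>
  moreover have "?b (pi / 6) = pi / 4"
    by (simp add: root_angle_def large_root_def sin_30 arctan_one)
  moreover have "5 * pi / 3 + 2 * (pi / 4 - pi / 6) = 2 * pi - pi / 6"
    "5 * pi / 3 + 2 * (0 - 0) = 2 * pi - pi / 3" "2 * (pi / 4 - pi / 6) = pi / 6"
    "2 * (pi / 6) = pi / 3" "2 * (pi / 4) = pi / 2" "pi - 2 * (pi / 4) = pi / 2"
    by simp_all
  moreover have "clausen (2 * pi - pi / 6) = - clausen (pi / 6)"
    "clausen (2 * pi - pi / 3) = - clausen (pi / 3)"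
    by (rule clausen_two_pi_minus; use pi_gt_zero in argo)+
  ultimately show ?thesis
    by (simp only: root_angle_0) (simp add: clausen_0 clausen_pi diff_divide_distrib)
qed

subsection \<open>Jensen's formula\<close>

text \<open>The mean value property: Ln (1 - a z) is holomorphic on the closed disc and vanishes at
  its centre.\<close>

lemma has_integral_ln_cmod_circle:
  assumes "cmod a < 1"
  shows "((\<lambda>t. ln (cmod (1 - a * cis t))) has_integral 0) {0..2 * pi}"
proof -
  have dom: "1 - a * z \<notin> \<real>\<^sub>\<le>\<^sub>0" if "cmod z \<le> 1" for z
  proof -
    have "cmod (a * z) < 1"
      using assms that mult_left_mono[of "cmod z" 1 "cmod a"] by (simp add: norm_mult)
    then have "Re (a * z) < 1"
      using complex_Re_le_cmod[of "a * z"] by linarith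
    then show ?thesis
      by (simp only: complex_nonpos_Reals_iff minus_complex.sel one_complex.sel) linarith
  qed
  have "(\<lambda>z. Ln (1 - a * z)) holomorphic_on cball 0 1"
    by (intro holomorphic_intros) (auto simp: dom)
  from Cauchy_integral_circlepath_simple[OF this, of 0]
  have "((\<lambda>u. Ln (1 - a * u) / u) has_contour_integral 0) (circlepath 0 1)"
    by simp
  then have "((\<lambda>t. \<i> * Ln (1 - a * cis t)) has_integral 0) {0..2 * pi}"
    by (simp add: circlepath_def has_contour_integral_part_circlepath_iff mult.commute)
  \<comment> \<open>The factor i comes from dz / z = i dt, so the imaginary part selects the real
    part of the logarithm.\<close>
  from has_integral_Im[OF this]
  have "((\<lambda>t. Re (Ln (1 - a * cis t))) has_integral 0) {0..2 * pi}"
    by simp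
  moreover have "Re (Ln (1 - a * cis t)) = ln (cmod (1 - a * cis t))" for t
    using dom[of "cis t"] by (intro Re_Ln) auto
  ultimately show ?thesis
    by simp
qed

text \<open>For |r| < 1 the distance |z - r| on the circle equals |1 - cnj r z|; for |r| > 1 the
  factor r is taken out. Both cases reduce to a vanishing mean.\<close>

lemma Jensen_linear:
  assumes "cmod r \<noteq> 1"
  shows "((\<lambda>t. ln (cmod (cis t - r))) has_integral 2 * pi * max 0 (ln (cmod r))) {0..2 * pi}"
proof (cases "cmod r < 1")
  case True
  have "cmod (cis t - r) = cmod (1 - cnj r * cis t)" for t
  proof -
    have "cmod (cis t - r) = cmod (cnj (cis t - r) * cis t)"
      by (simp only: norm_mult complex_mod_cnj norm_cis mult_1_right)
    also have "cnj (cis t - r) * cis t = 1 - cnj r * cis t"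
      by (simp add: algebra_simps cis_cnj cis_mult)
    finally show ?thesis .
  qed
  \<comment> \<open>For r = 0 this relies on the convention ln 0 = 0.\<close>
  moreover have "max 0 (ln (cmod r)) = 0"
    using True by (cases "r = 0") (auto simp: max_def)
  ultimately show ?thesis
    using has_integral_ln_cmod_circle[of "cnj r"] True by simp
next
  case False
  then have r: "cmod r > 1" "r \<noteq> 0"
    using assms by auto
  have eq: "ln (cmod (cis t - r)) = ln (cmod r) + ln (cmod (1 - 1 / r * cis t))" for t
  proof -
    have "cis t - r = - r * (1 - 1 / r * cis t)"
      using r by (simp add: algebra_simps)
    then have "cmod (cis t - r) = cmod r * cmod (1 - 1 / r * cis t)"
      by (metis norm_minus_cancel norm_mult)
    moreover have "cmod (cis t) \<noteq> cmod r"
      using r by simp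
    then have "cis t - r \<noteq> 0"
      by auto
    ultimately show ?thesis
      using r by (metis ln_mult norm_eq_zero mult_zero_right)
  qed
  have "((\<lambda>t. ln (cmod r)) has_integral 2 * pi * ln (cmod r)) {0..2 * pi}"
    using has_integral_const_real[of "ln (cmod r)" 0 "2 * pi"] by simp
  moreover have "((\<lambda>t. ln (cmod (1 - 1 / r * cis t))) has_integral 0) {0..2 * pi}"
    using r by (intro has_integral_ln_cmod_circle) (simp add: norm_divide)
  ultimately have "((\<lambda>t. ln (cmod (cis t - r))) has_integral 2 * pi * ln (cmod r) + 0) {0..2 * pi}"
    unfolding eq by (rule has_integral_add)
  then show ?thesis
    using r by (simp add: max_def)
qed

section \<open>Roots of the polynomial on the fibres of the torus\<close>

definition torus_poly :: "complex \<Rightarrow> complex \<Rightarrow> complex" where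
  "torus_poly x y = y\<^sup>2 + y * (x + 1) + x\<^sup>2 + x + 1"

text \<open>With x = e^2 and e e' = 1, the coefficients become x + 1 = e (e + e') and x^2 + x + 1 =
  e^2 ((e + e')^2 - 1), where e + e' = 2 cos (s / 2).\<close>

lemma torus_poly_factor:
  assumes "w + w' = - 2 * of_real (cos (s / 2))"
    and "w * w' = of_real (4 * (cos (s / 2))\<^sup>2 - 1)"
  shows "torus_poly (cis s) y = (y - cis (s / 2) * w) * (y - cis (s / 2) * w')"
proof -
  define e e' where "e = cis (s / 2)" and "e' = cis (- (s / 2))"
  have 1: "e * e' = 1"
    by (simp add: e_def e'_def cis_mult)
  have 2: "e + e' = 2 * of_real (cos (s / 2))"
    by (simp add: e_def e'_def complex_eq_iff)
  have "w + w' = - (e + e')" "w * w' = (e + e')\<^sup>2 - 1"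
    unfolding 2 by (simp_all add: assms power_mult_distrib)
  moreover have "cis s = e\<^sup>2"
    by (simp add: e_def power2_eq_square cis_mult)
  ultimately have "(y - e * w) * (y - e * w') = y\<^sup>2 + y * e * (e + e') + e\<^sup>2 * ((e + e')\<^sup>2 - 1)"
    by algebra
  also have "\<dots> = torus_poly (cis s) y"
    unfolding \<open>cis s = e\<^sup>2\<close> torus_poly_def using 1 by algebra
  finally show ?thesis
    by (simp add: e_def)
qed

text \<open>Multiplication by \<open>cis (s / 2)\<close> preserves moduli, so the linear formula
  applies to each factor. The nonvanishing serves the continuity of the logarithm on the
  fibre.\<close>

lemma Jensen_torus_poly:
  assumes "w + w' = - 2 * of_real (cos (s / 2))"
    and "w * w' = of_real (4 * (cos (s / 2))\<^sup>2 - 1)"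
    and w: "cmod w \<noteq> 1" "cmod w' \<noteq> 1"
  shows "((\<lambda>t. ln (cmod (torus_poly (cis s) (cis t)))) has_integral
      2 * pi * (max 0 (ln (cmod w)) + max 0 (ln (cmod w')))) {0..2 * pi}"
    and "torus_poly (cis s) (cis t) \<noteq> 0"
proof -
  let ?r = "cis (s / 2) * w" and ?r' = "cis (s / 2) * w'"
  have r: "cmod ?r = cmod w" "cmod ?r' = cmod w'"
    by (simp_all add: norm_mult)
  have "cmod (cis t) \<noteq> cmod ?r" "cmod (cis t) \<noteq> cmod ?r'" for t
    unfolding r using w by (metis norm_cis)+
  then have nz: "cis t - ?r \<noteq> 0" "cis t - ?r' \<noteq> 0" for t
    by (metis right_minus_eq)+
  have factor: "torus_poly (cis s) (cis t) = (cis t - ?r) * (cis t - ?r')" for t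
    using torus_poly_factor[OF assms(1,2)] .
  then show "torus_poly (cis s) (cis t) \<noteq> 0"
    using nz by simp
  have "((\<lambda>t. ln (cmod (cis t - ?r)) + ln (cmod (cis t - ?r'))) has_integral
      2 * pi * max 0 (ln (cmod ?r)) + 2 * pi * max 0 (ln (cmod ?r'))) {0..2 * pi}"
    using w by (intro has_integral_add Jensen_linear) (simp_all only: r not_False_eq_True)
  moreover have "ln (cmod (cis t - ?r)) + ln (cmod (cis t - ?r')) =
      ln (cmod (torus_poly (cis s) (cis t)))" for t
    using nz[of t] by (simp add: factor norm_mult ln_mult)
  ultimately show "((\<lambda>t. ln (cmod (torus_poly (cis s) (cis t)))) has_integral
      2 * pi * (max 0 (ln (cmod w)) + max 0 (ln (cmod w')))) {0..2 * pi}"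
    by (simp only: r distrib_left)
qed

text \<open>
  The logarithmic Mahler measure of \<open>w\<^sup>2 + 2 a w + 4 a\<^sup>2 - 1\<close>; only relevant for
  \<open>0 \<le> a \<le> 1\<close>, and off the breakpoints \<open>0, 1 / 2, 1 / \<surd>2\<close>, where a root lies on the unit circle.
\<close>
definition fibre_measure :: "real \<Rightarrow> real" where
  "fibre_measure a = (if a > 1 / sqrt 2 then ln (4 * a\<^sup>2 - 1)
     else if a > 1 / 2 then 0 else ln (a + sqrt (1 - 3 * a\<^sup>2)))"

text \<open>If 3 c^2 > 1, the roots are conjugate of modulus sqrt (4 c^2 - 1), which passes 1 at c^2
  = 1 / 2. Otherwise they are real of moduli |c| + q and ||c| - q|; the latter is below 1 and the
  former passes 1 at |c| = 1 / 2.\<close>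

lemma torus_poly_roots:
  fixes c :: real
  assumes c: "c \<noteq> 0" "\<bar>c\<bar> \<noteq> 1 / 2" "\<bar>c\<bar> \<noteq> 1 / sqrt 2"
  obtains w w' where "w + w' = - 2 * of_real c" "w * w' = of_real (4 * c\<^sup>2 - 1)"
    "cmod w \<noteq> 1" "cmod w' \<noteq> 1"
    "max 0 (ln (cmod w)) + max 0 (ln (cmod w')) = fibre_measure \<bar>c\<bar>"
proof (cases "3 * c\<^sup>2 > 1")
  case True
  define q where "q = sqrt (3 * c\<^sup>2 - 1)"
  have q: "q\<^sup>2 = 3 * c\<^sup>2 - 1"
    using True by (simp add: q_def)
  let ?w = "Complex (- c) q" and ?w' = "Complex (- c) (- q)"
  have norm: "cmod ?w = sqrt (4 * c\<^sup>2 - 1)" "cmod ?w' = sqrt (4 * c\<^sup>2 - 1)"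
    by (simp_all add: cmod_def q)
  have iff: "\<bar>c\<bar> > 1 / sqrt 2 \<longleftrightarrow> 2 * c\<^sup>2 > 1" and neq: "2 * c\<^sup>2 \<noteq> 1"
  proof -
    have "(1 / sqrt 2)\<^sup>2 = (1 / 2 :: real)"
      by (simp add: power_divide)
    then show "\<bar>c\<bar> > 1 / sqrt 2 \<longleftrightarrow> 2 * c\<^sup>2 > 1" "2 * c\<^sup>2 \<noteq> 1"
      using abs_le_square_iff[of c "1 / sqrt 2"] c(3) power2_eq_iff_nonneg[of "\<bar>c\<bar>" "1 / sqrt 2"]
      by (auto simp: not_le[symmetric])
  qed
  have half: "\<bar>c\<bar> > 1 / 2"
    using True abs_le_square_iff[of c "1 / 2"] by (auto simp: power2_eq_square not_le[symmetric])
  have "2 * max 0 (ln (sqrt (4 * c\<^sup>2 - 1))) = fibre_measure \<bar>c\<bar>"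
    using True neq half by (auto simp: fibre_measure_def iff ln_sqrt max_def)
  then show ?thesis
    using q neq by (intro that[of ?w ?w'])
      (auto simp: norm complex_eq_iff power2_eq_square algebra_simps)
next
  case False
  define q where "q = sqrt (1 - 3 * c\<^sup>2)"
  have q: "q\<^sup>2 = 1 - 3 * \<bar>c\<bar>\<^sup>2" "q \<ge> 0"
    using False by (simp_all add: q_def)
  define a where "a = \<bar>c\<bar>"
  have a: "a > 0" "a \<noteq> 1 / 2" "c = sgn c * a" "(sgn c)\<^sup>2 = 1"
    using c by (auto simp: a_def sgn_if)
  have q2: "q\<^sup>2 = 1 - 3 * a\<^sup>2"
    using q by (simp add: a_def)
  have "a\<^sup>2 \<le> 1 / 3"
    using False by (simp add: a_def)
  then have "a \<le> sqrt (1 / 2)"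
    by (intro real_le_rsqrt) simp
  then have "a \<le> 1 / sqrt 2"
    by (simp add: real_sqrt_divide)
  have "\<bar>a - q\<bar> < 1"
  proof -
    have "q\<^sup>2 < 1" "a\<^sup>2 < 1"
      using q2 zero_less_power[OF a(1), of 2] \<open>a\<^sup>2 \<le> 1 / 3\<close> by linarith+
    then have "q < 1" "a < 1"
      by (simp_all add: abs_square_less_1)
    then show ?thesis
      using a q by auto
  qed
  have less: "a + q < 1 \<longleftrightarrow> a > 1 / 2" and neq: "a + q \<noteq> 1"
  proof -
    \<comment> \<open>The conjugate factor 1 - a + q is positive, so the sign of 1 - a - q is that
      of 2 a - 1.\<close>
    have "(1 - a - q) * (1 - a + q) = 2 * a * (2 * a - 1)"
      using q2 by (simp add: algebra_simps power2_eq_square)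
    moreover have "1 - a + q > 0"
      using \<open>\<bar>a - q\<bar> < 1\<close> by linarith
    ultimately have "0 < 1 - a - q \<longleftrightarrow> 0 < 2 * a * (2 * a - 1)" "1 - a - q = 0 \<longleftrightarrow> 2 * a * (2 * a - 1) = 0"
      by (metis zero_less_mult_pos2 mult_pos_pos, metis mult_eq_0_iff less_irrefl)
    then show "a + q < 1 \<longleftrightarrow> a > 1 / 2" "a + q \<noteq> 1"
      using a(1,2) by (auto simp: zero_less_mult_iff)
  qed
  let ?w = "of_real (- sgn c * (a + q)) :: complex" and ?w' = "of_real (- sgn c * (a - q)) :: complex"
  have norm: "cmod ?w = a + q" "cmod ?w' = \<bar>a - q\<bar>"
    using a q c unfolding norm_of_real abs_mult by (auto simp: abs_sgn_eq)
  have "- sgn c * (a + q) + - sgn c * (a - q) = - 2 * c"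
    using a(3) by (simp add: algebra_simps)
  then have sum: "?w + ?w' = - 2 * of_real c"
    by (metis of_real_add of_real_mult of_real_minus of_real_numeral)
  have "- sgn c * (a + q) * (- sgn c * (a - q)) = (sgn c)\<^sup>2 * (a\<^sup>2 - q\<^sup>2)"
    by (simp add: algebra_simps power2_eq_square)
  also have "\<dots> = 4 * c\<^sup>2 - 1"
    unfolding a(4) q2 by (simp add: a_def)
  finally have prod: "?w * ?w' = of_real (4 * c\<^sup>2 - 1)"
    by (simp only: of_real_mult[symmetric])
  \<comment> \<open>If a = q, one root is 0 and the convention ln 0 = 0 gives the right
    value.\<close>
  have "max 0 (ln \<bar>a - q\<bar>) = 0"
    using \<open>\<bar>a - q\<bar> < 1\<close> by (cases "a = q") (auto simp: max_def)
  moreover have "max 0 (ln (a + q)) = (if a > 1 / 2 then 0 else ln (a + q))"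
  proof -
    have "a + q > 0"
      using a q by simp
    then show ?thesis
      using less neq by (auto simp: max_def)
  qed
  then have "max 0 (ln (a + q)) = fibre_measure a"
    using \<open>a \<le> 1 / sqrt 2\<close> by (simp add: fibre_measure_def q_def a_def)
  ultimately have "max 0 (ln (cmod ?w)) + max 0 (ln (cmod ?w')) = fibre_measure \<bar>c\<bar>"
    unfolding norm a_def[symmetric] by simp
  then show ?thesis
    using sum prod neq \<open>\<bar>a - q\<bar> < 1\<close> by (intro that[of ?w ?w']) (simp_all only: norm, auto)
qed

subsection \<open>Integration over the torus\<close>

lemma abs_cos_half_less_inv_sqrt2:
  "\<bar>cos (s / 2)\<bar> > 1 / sqrt 2 \<longleftrightarrow> cos s > 0"
proof -
  have "1 / sqrt 2 < \<bar>cos (s / 2)\<bar> \<longleftrightarrow> (1 / sqrt 2)\<^sup>2 < \<bar>cos (s / 2)\<bar>\<^sup>2"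
    by (intro iffI power_strict_mono) (auto intro: power2_less_imp_less)
  also have "\<dots> \<longleftrightarrow> cos s > 0"
    using cos_double_cos[of "s / 2"] by (simp add: power_divide mult.commute)
  finally show ?thesis .
qed

text \<open>The breakpoints 1 / sqrt 2 and 1 / 2 of cos (s / 2) sit at s = pi / 2 and s = 2 pi / 3.
  On the first interval 4 cos^2 (s / 2) - 1 = 1 + 2 cos s; on the middle one the integrand is 0 off
  an endpoint.\<close>

lemma has_integral_fibre_measure_half:
  "((\<lambda>s. fibre_measure \<bar>cos (s / 2)\<bar>) has_integral
     clausen (pi / 6) + clausen (5 * pi / 6) + 2 * (clausen (pi / 2) - clausen (pi / 6))) {0..pi}"
proof -
  let ?g = "\<lambda>s. fibre_measure \<bar>cos (s / 2)\<bar>"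
  have "(?g has_integral clausen (pi / 6) + clausen (5 * pi / 6)) {0..pi / 2}"
  proof (rule has_integral_spike_finite[OF _ _ has_integral_ln_one_plus_two_cos])
    fix s assume "s \<in> {0..pi / 2} - {pi / 2}"
    then have "cos s > 0"
      by (intro cos_gt_zero_pi) auto
    then show "?g s = ln (1 + 2 * cos s)"
      using cos_double_cos[of "s / 2"] by (simp add: fibre_measure_def abs_cos_half_less_inv_sqrt2)
  qed simp
  moreover have "(?g has_integral 0) {pi / 2..2 * pi / 3}"
  proof (rule has_integral_spike_finite[of "{2 * pi / 3}"])
    fix s assume s: "s \<in> {pi / 2..2 * pi / 3} - {2 * pi / 3}"
    have "cos s \<le> 0"
      using s cos_monotone_0_pi_le[of "pi / 2" s] by auto
    moreover have "cos (s / 2) > cos (pi / 3)"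
      using s by (intro cos_monotone_0_pi) auto
    ultimately have "\<not> \<bar>cos (s / 2)\<bar> > 1 / sqrt 2" "\<bar>cos (s / 2)\<bar> > 1 / 2"
      unfolding abs_cos_half_less_inv_sqrt2 cos_60 by linarith+
    then show "?g s = 0"
      unfolding fibre_measure_def by (simp only: if_True if_False)
  qed auto
  moreover have "(?g has_integral 2 * (clausen (pi / 2) - clausen (pi / 6))) {2 * pi / 3..pi}"
  proof (rule has_integral_spike_finite[of "{}"])
    \<comment> \<open>The substitution t = s / 2 - pi / 3 doubles the integral.\<close>
    have "((\<lambda>s. ln (large_root ((1 / 2) *\<^sub>R s + - (pi / 3)))) has_integral
        (clausen (pi / 2) - clausen (pi / 6)) /\<^sub>R (1 / 2) ^ DIM(real))
        (cbox ((0 - - (pi / 3)) /\<^sub>R (1 / 2)) ((pi / 6 - - (pi / 3)) /\<^sub>R (1 / 2)))"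
      by (rule has_integral_affinity') (simp_all add: has_integral_ln_large_root)
    moreover have "(pi / 6 - - (pi / 3)) /\<^sub>R (1 / 2) = pi" "(0 - - (pi / 3)) /\<^sub>R (1 / 2) = 2 * pi / 3"
      "(1 / 2) *\<^sub>R s + - (pi / 3) = s / 2 - pi / 3" "x /\<^sub>R (1 / 2) ^ DIM(real) = 2 * x" for s x :: real
      by simp_all
    ultimately show "((\<lambda>s. ln (large_root (s / 2 - pi / 3))) has_integral
        2 * (clausen (pi / 2) - clausen (pi / 6))) {2 * pi / 3..pi}"
      by (simp only: box_real)
    fix s assume s: "s \<in> {2 * pi / 3..pi} - {}"
    have "cos s \<le> 0"
      using s cos_monotone_0_pi_le[of "pi / 2" s] by auto
    moreover have "cos (s / 2) \<le> cos (pi / 3)"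
      using s by (intro cos_monotone_0_pi_le) auto
    moreover have "cos (s / 2) \<ge> 0"
      using s by (intro cos_ge_zero) auto
    ultimately have "\<not> \<bar>cos (s / 2)\<bar> > 1 / sqrt 2" "\<not> \<bar>cos (s / 2)\<bar> > 1 / 2"
      "\<bar>cos (s / 2)\<bar> = cos (s / 2)"
      unfolding abs_cos_half_less_inv_sqrt2 cos_60 by linarith+
    then show "?g s = ln (large_root (s / 2 - pi / 3))"
      unfolding fibre_measure_def large_root_def
      by (simp only: if_False diff_add_cancel)
  qed simp
  ultimately have "(?g has_integral clausen (pi / 6) + clausen (5 * pi / 6) +
      (0 + 2 * (clausen (pi / 2) - clausen (pi / 6)))) {0..pi}"
    by (intro has_integral_combine[of 0 "pi / 2" pi] has_integral_combine[of "pi / 2" "2 * pi / 3" pi])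
      auto
  then show ?thesis
    by simp
qed

text \<open>The reflection of s to 2 pi - s changes only the sign of cos (s / 2), so the full
  integral is twice the one over [0, pi].\<close>

lemma has_integral_fibre_measure:
  "((\<lambda>s. fibre_measure \<bar>cos (s / 2)\<bar>) has_integral
     2 * (2 * bloch_wigner \<i> - 3 / 4 * bloch_wigner (cis (2 * pi / 3)))) {0..2 * pi}"
proof -
  let ?g = "\<lambda>s. fibre_measure \<bar>cos (s / 2)\<bar>"
  let ?I = "clausen (pi / 6) + clausen (5 * pi / 6) + 2 * (clausen (pi / 2) - clausen (pi / 6))"
  have image: "(\<lambda>x. - x + 2 * pi) ` {0..pi} = {pi..2 * pi}"
    using image_affinity_atLeastAtMost[of "-1" "2 * pi" 0 pi] by simp
  have "((\<lambda>s. ?g (- s + 2 * pi)) has_integral ?I) {pi..2 * pi}"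
    using has_integral_affinity[of ?g ?I 0 pi "-1" "2 * pi", unfolded box_real]
      has_integral_fibre_measure_half image by simp
  moreover have "?g (- s + 2 * pi) = ?g s" for s
  proof -
    have "(- s + 2 * pi) / 2 = pi - s / 2"
      by simp
    then show ?thesis
      by (simp only: cos_pi_minus abs_minus_cancel)
  qed
  ultimately have "(?g has_integral ?I) {pi..2 * pi}"
    by simp
  then have "(?g has_integral ?I + ?I) {0..2 * pi}"
    using has_integral_fibre_measure_half by (intro has_integral_combine[of 0 pi "2 * pi"]) auto
  moreover have "?I + ?I = 2 * (2 * bloch_wigner \<i> - 3 / 4 * bloch_wigner (cis (2 * pi / 3)))"
  proof -
    \<comment> \<open>Duplication at pi / 6 gives Cl(5 pi / 6) - Cl(pi / 6) = -Cl(pi / 3) / 2, and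
      at pi / 3 it gives 2 Cl(pi / 3) = 3 Cl(2 pi / 3); hence the coefficient -3 / 4.\<close>
    have "clausen (pi / 3) = 2 * clausen (pi / 6) - 2 * clausen (5 * pi / 6)"
      using clausen_double[of "pi / 6"] by simp
    moreover have "clausen (2 * pi / 3) = 2 * clausen (pi / 3) - 2 * clausen (2 * pi / 3)"
      using clausen_double[of "pi / 3"] by simp
    moreover have "clausen (pi / 2) = bloch_wigner \<i>"
      "clausen (2 * pi / 3) = bloch_wigner (cis (2 * pi / 3))"
      by (simp_all add: clausen_def)
    ultimately show ?thesis
      by argo
  qed
  ultimately show ?thesis
    by (simp only:)
qed

section \<open>Fubini for functions bounded above, applied to the torus\<close>

lemma set_integrable_bounded_above:
  fixes f :: "real \<Rightarrow> real"
  assumes cont: "continuous_on {a..b} f" and I: "(f has_integral I) {a..b}"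
    and "a \<le> b" "\<And>t. f t \<le> B" "B \<ge> 0"
  shows "set_integrable lborel {a..b} f" "(LBINT t:{a..b}. f t) = I"
    "(LBINT t:{a..b}. \<bar>f t\<bar>) \<le> 2 * B * (b - a) - I"
proof -
  show int: "set_integrable lborel {a..b} f"
    using borel_integrable_atLeastAtMost'[OF cont] .
  show eq: "(LBINT t:{a..b}. f t) = I"
    using set_borel_integral_eq_integral(2)[OF int] I by (simp add: integral_unique)
  have const: "set_integrable lborel {a..b} (\<lambda>_. 2 * B)"
    by (rule borel_integrable_atLeastAtMost') simp
  have "(LBINT t:{a..b}. \<bar>f t\<bar>) \<le> (LBINT t:{a..b}. 2 * B - f t)"
  proof (rule set_integral_mono)
    show "set_integrable lborel {a..b} (\<lambda>t. \<bar>f t\<bar>)"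
      by (rule set_integrable_abs[OF int])
    show "set_integrable lborel {a..b} (\<lambda>t. 2 * B - f t)"
      by (rule set_integral_diff(1)[OF const int])
    \<comment> \<open>Where f is nonnegative this is f \<le> B; where it is negative, it is B \<ge>
      0.\<close>
    show "\<bar>f t\<bar> \<le> 2 * B - f t" for t
      using assms(4)[of t] \<open>B \<ge> 0\<close> by auto
  qed
  also have "\<dots> = (LBINT t:{a..b}. 2 * B) - (LBINT t:{a..b}. f t)"
    by (rule set_integral_diff(2)[OF const int])
  also have "(LBINT t:{a..b}. 2 * B) = 2 * B * (b - a)"
    using \<open>a \<le> b\<close> by (simp add: set_integral_const mult.commute)
  finally show "(LBINT t:{a..b}. \<bar>f t\<bar>) \<le> 2 * B * (b - a) - I"
    unfolding eq .
qed

text \<open>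
  Fubini for an integrand bounded above but not below: \<open>\<bar>g\<bar> \<le> 2 B - g\<close>, so integrability
  follows from the lower bound on the inner integrals.
\<close>
lemma set_integral_square_bounded_above:
  fixes g :: "real \<Rightarrow> real \<Rightarrow> real" and a b :: real
  defines "A \<equiv> {a..b}"
  assumes meas: "case_prod g \<in> borel_measurable borel"
    and "a \<le> b" and B: "B \<ge> 0" "\<And>s t. g s t \<le> B"
    and E: "finite E"
    and cont: "\<And>s. s \<in> A - E \<Longrightarrow> continuous_on A (g s)"
    and inner: "\<And>s. s \<in> A - E \<Longrightarrow> (g s has_integral h s) A"
    and h: "\<And>s. s \<in> A - E \<Longrightarrow> h s \<ge> 0"
    and outer: "(h has_integral I) A"
  shows "(LINT z:A \<times> A|lborel. case_prod g z) = I"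
proof -
  define f where "f = (\<lambda>z. indicator (A \<times> A) z * case_prod g z)"
  have f: "f (s, t) = indicator A s * (indicator A t * g s t)" for s t
    by (simp add: f_def indicator_times)
  have A: "A \<in> sets borel"
    by (simp add: A_def)
  have "A \<times> A \<in> sets (borel :: (real \<times> real) measure)"
    using A by (simp add: borel_prod[symmetric])
  then have meas_f: "f \<in> borel_measurable (lborel \<Otimes>\<^sub>M lborel)"
    unfolding lborel_prod f_def using meas by (simp add: borel_measurable_times)
  have AE: "AE s in lborel. s \<notin> E"
    using finite_imp_null_set_lborel[OF E] by (rule AE_not_in)
  note inner' = set_integrable_bounded_above[OF cont[unfolded A_def] inner[unfolded A_def] \<open>a \<le> b\<close> B(2) B(1),
      folded A_def, unfolded set_integrable_def set_lebesgue_integral_def, simplified]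
  have integrable_inner: "AE s in lborel. integrable lborel (\<lambda>t. f (s, t))"
    using AE
  proof eventually_elim
    case (elim s)
    then show ?case
      using inner'(1)[of s] by (cases "s \<in> A") (simp_all add: f)
  qed
  have meas_norm: "(\<lambda>s. LINT t|lborel. norm (f (s, t))) \<in> borel_measurable lborel"
    using meas_f by measurable
  have integrable_outer: "integrable lborel (\<lambda>s. LINT t|lborel. norm (f (s, t)))"
  proof (rule Bochner_Integration.integrable_bound)
    show "integrable lborel (\<lambda>s. indicator A s * (2 * B * (b - a)))"
      using borel_integrable_atLeastAtMost'[of a b "\<lambda>_. 2 * B * (b - a)"]
      by (simp add: set_integrable_def A_def)
    show "AE s in lborel. norm (LINT t|lborel. norm (f (s, t))) \<le> norm (indicator A s * (2 * B * (b - a)))"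
      using AE
    proof eventually_elim
      case (elim s)
      show ?case
      proof (cases "s \<in> A")
        case True
        have "(LINT t|lborel. norm (f (s, t))) = (LINT t|lborel. indicator A t * \<bar>g s t\<bar>)"
          using True by (simp add: f abs_mult)
        \<comment> \<open>The inner bound is 2 B (b - a) - h s, and h s \<ge> 0 makes it uniform in
          s.\<close>
        also have "\<dots> \<le> 2 * B * (b - a)"
          using inner'(3)[of s] h[of s] True elim by auto
        finally show ?thesis
          using True by simp
      qed (simp add: f)
    qed
  qed (rule meas_norm)
  have integrable: "integrable (lborel \<Otimes>\<^sub>M lborel) f"
    using meas_f integrable_outer integrable_inner by (rule lborel_pair.Fubini_integrable)
  define H where "H = (\<lambda>s. LINT t|lborel. f (s, t))"
  have H: "integrable lborel H"
    unfolding H_def using integrable by (rule lborel_pair.integrable_fst')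
  have H_eq: "H s = indicator A s * h s" if "s \<notin> E" for s
    using inner'(2)[of s] that by (cases "s \<in> A") (simp_all add: H_def f)
  have "(H has_integral (LINT s|lborel. H s)) UNIV"
    using H by (rule has_integral_integral_lborel)
  moreover have "(H has_integral I) UNIV"
  proof -
    have "((\<lambda>s. if s \<in> A then h s else 0) has_integral I) UNIV"
      using outer by (simp add: has_integral_restrict_UNIV)
    then show ?thesis
      by (rule has_integral_spike_finite[OF E, rotated]) (auto simp: H_eq)
  qed
  ultimately have "(LINT s|lborel. H s) = I"
    by (rule has_integral_unique)
  then show ?thesis
    using lborel_pair.integral_fst'[OF integrable]
    by (simp add: H_def lborel_prod f_def set_lebesgue_integral_def)
qed

lemma set_integral_ln_torus_poly:
  "(LINT z:{0..2 * pi} \<times> {0..2 * pi}|lborel. case_prod (\<lambda>s t. ln (cmod (torus_poly (cis s) (cis t)))) z) =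
     2 * pi * (2 * (2 * bloch_wigner \<i> - 3 / 4 * bloch_wigner (cis (2 * pi / 3))))"
proof (rule set_integral_square_bounded_above)
  have "continuous_on UNIV (\<lambda>z. cmod (torus_poly (cis (fst z)) (cis (snd z))))"
    unfolding torus_poly_def by (intro continuous_intros)
  then show "(\<lambda>(s, t). ln (cmod (torus_poly (cis s) (cis t)))) \<in> borel_measurable borel"
    unfolding case_prod_beta by (intro borel_measurable_ln borel_measurable_continuous_onI)
  show "0 \<le> ln (6 :: real)"
    by simp
  \<comment> \<open>The polynomial is a sum of six monomials of modulus 1 on the torus; at its zeros
    the value ln 0 = 0 satisfies the bound.\<close>
  show "ln (cmod (torus_poly (cis s) (cis t))) \<le> ln 6" for s t
  proof -
    have "torus_poly (cis s) (cis t) = cis (2 * t) + cis t * cis s + cis t + cis (2 * s) + cis s + 1"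
      by (simp add: torus_poly_def power2_eq_square cis_mult algebra_simps)
    then have "cmod (torus_poly (cis s) (cis t)) \<le> 1 + 1 + 1 + 1 + 1 + 1"
      by (simp only:) (intro norm_triangle_mono; simp add: norm_mult)
    then show ?thesis
      by (cases "torus_poly (cis s) (cis t) = 0") (simp_all add: ln_le_cancel_iff)
  qed
  \<comment> \<open>The fibres at the breakpoints of \<open>fibre_measure\<close>; there are
    finitely many since cos (s / 2) is injective on [0, 2 pi].\<close>
  let ?E = "{s \<in> {0..2 * pi}. \<bar>cos (s / 2)\<bar> \<in> {0, 1 / 2, 1 / sqrt 2}}"
  show "finite ?E"
  proof -
    have "inj_on (\<lambda>s. cos (s / 2)) {0..2 * pi}"
    proof (rule inj_onI)
      fix x y :: real
      assume "x \<in> {0..2 * pi}" "y \<in> {0..2 * pi}" "cos (x / 2) = cos (y / 2)"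
      then have "x / 2 = y / 2"
        by (intro cos_inj_pi[of "x / 2" "y / 2"]) simp_all
      then show "x = y" by simp
    qed
    moreover have "finite {0, 1 / 2, 1 / sqrt 2, - 1 / 2, - 1 / sqrt 2 :: real}"
      by simp
    ultimately have "finite ((\<lambda>s. cos (s / 2)) -` {0, 1 / 2, 1 / sqrt 2, - 1 / 2, - 1 / sqrt 2} \<inter> {0..2 * pi})"
      by (intro finite_vimage_IntI)
    then show ?thesis
      by (rule finite_subset[rotated]) (auto simp: abs_eq_iff')
  qed
  fix s assume s: "s \<in> {0..2 * pi} - ?E"
  obtain w w' where w: "w + w' = - 2 * of_real (cos (s / 2))"
    "w * w' = of_real (4 * (cos (s / 2))\<^sup>2 - 1)" "cmod w \<noteq> 1" "cmod w' \<noteq> 1"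
    "max 0 (ln (cmod w)) + max 0 (ln (cmod w')) = fibre_measure \<bar>cos (s / 2)\<bar>"
    using s torus_poly_roots[of "cos (s / 2)"] by auto
  show "((\<lambda>t. ln (cmod (torus_poly (cis s) (cis t)))) has_integral
      2 * pi * fibre_measure \<bar>cos (s / 2)\<bar>) {0..2 * pi}"
    using Jensen_torus_poly(1)[OF w(1-4)] unfolding w(5) .
  show "0 \<le> 2 * pi * fibre_measure \<bar>cos (s / 2)\<bar>"
    unfolding w(5)[symmetric] by simp
  have "torus_poly (cis s) (cis t) \<noteq> 0" for t
    using Jensen_torus_poly(2)[OF w(1-4)] .
  then show "continuous_on {0..2 * pi} (\<lambda>t. ln (cmod (torus_poly (cis s) (cis t))))"
    unfolding torus_poly_def by (intro continuous_intros) auto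
next
  show "((\<lambda>s. 2 * pi * fibre_measure \<bar>cos (s / 2)\<bar>) has_integral
     2 * pi * (2 * (2 * bloch_wigner \<i> - 3 / 4 * bloch_wigner (cis (2 * pi / 3))))) {0..2 * pi}"
    by (rule has_integral_mult_right[OF has_integral_fibre_measure])
qed simp

theorem proposition11:
  fixes P :: "complex \<Rightarrow> complex \<Rightarrow> complex" and \<omega> :: complex
  assumes "\<And>x y. P x y = y\<^sup>2 + y * (x + 1) + x\<^sup>2 + x + 1"
    and "\<omega> = exp (2 * complex_of_real pi * \<i> / 3)"
  shows "complex_of_real pi * mahler_measure P =
           complex_of_real (2 * bloch_wigner \<i> - 3 / 4 * bloch_wigner \<omega>)"
proof -
  define L where "L = (\<lambda>s t. ln (cmod (torus_poly (cis s) (cis t))))"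
  let ?R = "2 * bloch_wigner \<i> - 3 / 4 * bloch_wigner (cis (2 * pi / 3))"
  have P: "P = torus_poly"
    using assms(1) by (intro ext) (simp add: torus_poly_def)
  have \<omega>: "\<omega> = cis (2 * pi / 3)"
    by (simp add: assms(2) cis_conv_exp mult_ac)
  \<comment> \<open>The factors i from dx and dy produce a minus sign, which cancels against (2 pi
    i)^2 = -4 pi^2.\<close>
  have "complex_of_real r / (cis s * cis t) * (\<i> * cis s) * (\<i> * cis t) = of_real (- r)" for r s t
    by (simp add: field_simps)
  then have "torus_integral (\<lambda>x y. of_real (ln (cmod (P x y))) / (x * y)) =
      (LINT (s, t):{0..2 * pi} \<times> {0..2 * pi}|lborel. of_real (- L s t))"
    by (simp only: torus_integral_def P L_def)
  also have "\<dots> = of_real (- (LINT z:{0..2 * pi} \<times> {0..2 * pi}|lborel. case_prod L z))"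
    by (simp add: set_lebesgue_integral_def case_prod_beta scaleR_conv_of_real
        flip: of_real_mult integral_of_real)
  also have "(LINT z:{0..2 * pi} \<times> {0..2 * pi}|lborel. case_prod L z) = 2 * pi * (2 * ?R)"
    unfolding L_def by (rule set_integral_ln_torus_poly)
  finally show ?thesis
    unfolding mahler_measure_def \<omega> by (simp add: power_mult_distrib power2_eq_square)
qed

end
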